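(* Let $n \geq 1$ and $\lambda \vdash n$. Set $$N = \begin{cases} N(\lambda) & \text{if } 2N(\lambda)+1 \leq n, \\ \left\lfloor \frac{n-1}{2} \right\rfloor & \text{if } 2N(\lambda)+1 > n, \end{cases}$$ where $N(\lambda) = |\lambda| - \max_{c \in \lambda} h_c^{\mathrm{op}}$. Then for any integer $0 \leq M \leq N$, $$\prod_{c \in \lambda} h_c^{\mathrm{op}} \leq (n-M)!\,(M+1)!.$$ Moreover, $$f^\lambda \geq \frac{1}{M+1}\binom{n}{M}.$$
   Context: $\lambda \vdash n$ means that $\lambda$ is an integer partition of size $|\lambda| = n$. A partition $\lambda = (\lambda_1 \geq \cdots \geq \lambda_m \geq 0)$ is identified with its set of cells $\{(a,b) \in \mathbb{Z}\times\mathbb{Z} : 1 \leq b \leq m,\ 1 \leq a \leq \lambda_b\}$. The opposite hook length of a cell $c=(a,b) \in \lambda$ is $h_c^{\mathrm{op}} = a+b-1$. $N(\lambda)$ is called the diagonal excess of $\lambda$. $f^\lambda$ is the number of standard Young tableaux of shape $\lambda$, equivalently the dimension of the irreducible complex $S_n$-module indexed by $\lambda$. *)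

theory Defs
  imports Complex_Main "HOL-Library.FuncSet"
begin

text \<open>Trailing zero parts are allowed in a partition; they contribute no cells.\<close>

definition is_partition :: "nat list \<Rightarrow> nat \<Rightarrow> bool" where
  "is_partition lam n \<longleftrightarrow> sorted_wrt (\<ge>) lam \<and> sum_list lam = n"

text \<open>A cell is a pair (column, row), both counted from 1, whereas list positions are counted from 0.\<close>

definition cells :: "nat list \<Rightarrow> (nat \<times> nat) set" where
  "cells lam = {(a, b). 1 \<le> b \<and> b \<le> length lam \<and> 1 \<le> a \<and> a \<le> lam ! (b - 1)}"

definition op_hook :: "nat \<times> nat \<Rightarrow> nat" where
  "op_hook c = fst c + snd c - 1"

text \<open>
  The subtraction does not truncate: if (a, b) is a cell, then so are all (i, b) with
  1 \<open>\<le>\<close> i \<open>\<le>\<close> a and all (1, j) with 1 \<open>\<le>\<close> j \<open>\<le>\<close> b, which makes a + b - 1 distinct cells.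
\<close>

definition diagonal_excess :: "nat list \<Rightarrow> nat" where
  "diagonal_excess lam = sum_list lam - Max (op_hook ` cells lam)"

text \<open>
  Tableaux are total functions, required to be \<^const>\<open>undefined\<close> outside the shape so that
  each tableau is counted once.
\<close>

definition standard_tableaux :: "nat list \<Rightarrow> (nat \<times> nat \<Rightarrow> nat) set" where
  "standard_tableaux lam =
    {T \<in> extensional (cells lam).
       bij_betw T (cells lam) {1..sum_list lam} \<and>
       (\<forall>a a' b. (a, b) \<in> cells lam \<and> (a', b) \<in> cells lam \<and> a < a' \<longrightarrow> T (a, b) < T (a', b)) \<and>
       (\<forall>a b b'. (a, b) \<in> cells lam \<and> (a, b') \<in> cells lam \<and> b < b' \<longrightarrow> T (a, b) < T (a, b'))}"

definition num_SYT :: "nat list \<Rightarrow> nat" where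
  "num_SYT lam = card (standard_tableaux lam)"

end

theory Submission imports Defs "HOL-Library.Product_Order" begin

text \<open>
  Write $h_c$ for the opposite hook length of a cell $c$ and call \<open>M\<close> admissible for a diagram
  with $n$ cells if $h_c + M \<le> n$ for every cell $c$. Every \<open>M\<close> in the theorem is admissible,
  because $\lfloor (n-1)/2 \rfloor \<le> N(\lambda)$ when $2N(\lambda) + 1 > n$. Both bounds
  hold for all admissible \<open>M\<close>, and both are proved by removing corners (maximal cells).

  The induction turns on how many cells attain $h_c = n - M$. Removing a corner lowers $n$ by one,
  so \<open>M - 1\<close> always stays admissible, and \<open>M\<close> itself stays admissible unless some other cell attains
  $n - M$. If two cells attain it, hook-shaped paths to the two of them show that the
  diagram is large, $n \<ge> 2(n-M) - 1$ (\<open>two_equal_hooks\<close>), that is $n \<le> 2M + 1$.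

  For the product (\<open>prod_op_hook_le\<close>), remove a cell with the largest $h_c$. Its factor is
  absorbed by passing from $(n-1-M)!$ to $(n-M)!$ if \<open>M\<close> stays admissible, and from $M!$ to $(M+1)!$
  if two cells attain $n - M$, where $h_c = n - M \<le> M + 1$.

  The number $f$ of standard tableaux is bounded without the hook length formula. Since
  $\binom{n}{M}/(M+1) = \binom{n+1}{M+1}/(n+1)$, the claim is $\binom{n+1}{M+1} \<le> (n+1) f$. Tableaux are linear
  extensions of the diagram under the componentwise order, so $f$ is the sum of the numbers for
  the diagrams with one corner removed (\<open>num_ext_branching\<close>). If there are at least two corners, two of them suffice:
  Pascal's rule adds up the inductive bounds for \<open>M\<close> and \<open>M - 1\<close>, and if both removals
  only admit \<open>M - 1\<close>, then the inequality $n \<le> 2M + 1$ makes up for the difference (\<open>num_ext_two_maximal\<close>).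

  A diagram with one corner is a rectangle, where branching alone gains nothing.
  A rectangle with at least two rows and two columns satisfies the bound for the largest binomial coefficient
  (\<open>middle_binomial_le_rectangle\<close>). With two rows the count is a Catalan number and equality holds.
  A further row of length $p$ multiplies the count by at least the Catalan number $C_p$ (\<open>num_ext_add_row\<close>),
  while the required bound grows by a factor of at most $2^p$; and $C_p \<ge> 2^p$ as soon as $p \<ge> 5$.
  By transposing, the larger side may be taken as the row length, which leaves only the rectangles
  $3 \times 3$, $4 \times 3$ and $4 \times 4$ to be done by hand.
\<close>

section \<open>Linear extensions and the branching rule\<close>

definition linear_extensions :: "'a::order set \<Rightarrow> ('a \<Rightarrow> nat) set" where
  "linear_extensions S =
    {T \<in> extensional S. bij_betw T S {1..card S} \<and> strict_mono_on S T}"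

definition maximal_elements :: "'a::order set \<Rightarrow> 'a set" where
  "maximal_elements S = {c \<in> S. \<forall>d\<in>S. c \<le> d \<longrightarrow> d = c}"

definition num_ext :: "'a::order set \<Rightarrow> nat" where
  "num_ext S = card (linear_extensions S)"

lemma finite_linear_extensions: "finite S \<Longrightarrow> finite (linear_extensions S)"
  by (rule finite_subset[of _ "S \<rightarrow>\<^sub>E {1..card S}"])
    (auto simp: linear_extensions_def bij_betw_def PiE_iff extensional_def intro!: finite_PiE)

lemma num_ext_empty: "num_ext {} = 1"
proof -
  have "linear_extensions {} = {\<lambda>x::'a. undefined}"
    by (auto simp: linear_extensions_def extensional_def bij_betw_def strict_mono_on_def)
  then show ?thesis by (simp add: num_ext_def)
qed

text \<open>
  These two lemmas are the two directions of the branching rule: the largest value of a linear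
  extension sits on a maximal element, and removing or adding it there is reversible.
\<close>

lemma fun_upd_linear_extension:
  assumes S: "finite S" and c: "c \<in> maximal_elements S"
    and T: "T \<in> linear_extensions (S - {c})"
  shows "T(c := card S) \<in> linear_extensions S"
proof -
  have cS: "c \<in> S" and cmax: "\<And>d. d \<in> S \<Longrightarrow> c \<le> d \<Longrightarrow> d = c"
    using c by (auto simp: maximal_elements_def)
  have card: "card S = Suc (card (S - {c}))"
    using card.remove[OF S cS] by simp
  have b: "bij_betw T (S - {c}) {1..card (S - {c})}" and e: "T \<in> extensional (S - {c})"
    and m: "strict_mono_on (S - {c}) T"
    using T by (auto simp: linear_extensions_def)
  have "bij_betw (T(c := card S)) (S - {c}) {1..card (S - {c})}"
    using b by (subst bij_betw_cong[of _ _ T]) auto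
  then have "bij_betw (T(c := card S)) (S - {c} \<union> {c}) ({1..card (S - {c})} \<union> {card S})"
    using notIn_Un_bij_betw[of c "S - {c}" "T(c := card S)" "{1..card (S - {c})}"] card by simp
  moreover have "S - {c} \<union> {c} = S" using cS by auto
  moreover have "{1..card (S - {c})} \<union> {card S} = {1..card S}"
    using card by auto
  ultimately have "bij_betw (T(c := card S)) S {1..card S}" by simp
  moreover have "strict_mono_on S (T(c := card S))"
  proof (rule strict_mono_onI)
    fix x y assume xy: "x \<in> S" "y \<in> S" "x < y"
    have "x \<noteq> c" using cmax[of y] xy by (metis less_le)
    moreover have "T x < card S" if "x \<noteq> c"
      using bij_betwE[OF b] xy(1) that card by (metis DiffI atLeastAtMost_iff less_Suc_eq_le singletonD)
    ultimately show "(T(c := card S)) x < (T(c := card S)) y"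
      using xy m by (auto simp: strict_mono_on_def)
  qed
  moreover have "T(c := card S) \<in> extensional S"
    using e cS by (auto simp: extensional_def)
  ultimately show ?thesis by (simp add: linear_extensions_def)
qed

lemma linear_extension_top:
  assumes S: "finite S" "S \<noteq> {}" and T: "T \<in> linear_extensions S"
  obtains c where "c \<in> maximal_elements S" "T c = card S"
    "T(c := undefined) \<in> linear_extensions (S - {c})"
proof -
  have b: "bij_betw T S {1..card S}" and e: "T \<in> extensional S"
    and m: "strict_mono_on S T"
    using T by (auto simp: linear_extensions_def)
  have "card S \<in> {1..card S}" using S by (simp add: card_gt_0_iff Suc_le_eq)
  then obtain c where c: "c \<in> S" "T c = card S"
    using b by (metis bij_betw_imp_surj_on imageE)
  have card: "card S = Suc (card (S - {c}))"
    using card.remove[OF S(1) c(1)] by simp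
  have "c \<in> maximal_elements S"
  proof -
    have "d = c" if "d \<in> S" "c \<le> d" for d
    proof (rule ccontr)
      assume "d \<noteq> c"
      then have "T c < T d" using that m c(1) unfolding strict_mono_on_def
        by (metis order_le_neq_trans)
      moreover have "T d \<in> {1..card S}" using b that by (auto simp: bij_betw_def)
      ultimately show False using c by simp
    qed
    then show ?thesis using c by (auto simp: maximal_elements_def)
  qed
  moreover have "T(c := undefined) \<in> linear_extensions (S - {c})"
  proof -
    have "bij_betw T (S - {c}) ({1..card S} - {T c})"
      using b c(1) by (auto simp: bij_betw_def inj_on_def)
    moreover have "{1..card S} - {T c} = {1..card (S - {c})}"
      unfolding c(2) using card by auto
    ultimately have "bij_betw (T(c := undefined)) (S - {c}) {1..card (S - {c})}"
      by (subst bij_betw_cong[of _ _ T]) auto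
    moreover have "strict_mono_on (S - {c}) (T(c := undefined))"
      using m by (auto simp: strict_mono_on_def)
    moreover have "T(c := undefined) \<in> extensional (S - {c})"
      using e by (auto simp: extensional_def)
    ultimately show ?thesis by (simp add: linear_extensions_def)
  qed
  ultimately show thesis using that c by blast
qed

lemma num_ext_branching:
  assumes S: "finite S" "S \<noteq> {}"
  shows "num_ext S = (\<Sum>c\<in>maximal_elements S. num_ext (S - {c}))"
proof -
  let ?D = "SIGMA c:maximal_elements S. linear_extensions (S - {c})"
  let ?f = "\<lambda>(c, T). T(c := card S)"
  have inj: "inj_on ?f ?D"
  proof (rule inj_onI, clarify)
    fix c T c' T'
    assume c: "c \<in> maximal_elements S" and T: "T \<in> linear_extensions (S - {c})"
      and c': "c' \<in> maximal_elements S" and T': "T' \<in> linear_extensions (S - {c'})"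
      and eq: "T(c := card S) = T'(c' := card S)"
    have "inj_on (T(c := card S)) S"
      using fun_upd_linear_extension[OF S(1) c T]
      by (auto simp: linear_extensions_def bij_betw_def)
    moreover have "(T(c := card S)) c' = (T(c := card S)) c"
      using fun_cong[OF eq, of c'] by simp
    ultimately have cc: "c = c'"
      using c c' unfolding maximal_elements_def by (blast dest: inj_onD)
    have "T c = undefined" "T' c = undefined"
      using T T' cc by (auto simp: linear_extensions_def extensional_def)
    then have "T = T'"
      using eq cc by (metis fun_upd_triv fun_upd_upd)
    with cc show "c = c' \<and> T = T'" by simp
  qed
  have im: "?f ` ?D = linear_extensions S"
  proof
    show "?f ` ?D \<subseteq> linear_extensions S"
      using fun_upd_linear_extension[OF S(1)] by auto
    show "linear_extensions S \<subseteq> ?f ` ?D"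
    proof
      fix T assume "T \<in> linear_extensions S"
      then obtain c where c: "c \<in> maximal_elements S" "T c = card S"
          "T(c := undefined) \<in> linear_extensions (S - {c})"
        using linear_extension_top[OF S] by blast
      have "T = ?f (c, T(c := undefined))" using c(2) by auto
      then show "T \<in> ?f ` ?D" using c by blast
    qed
  qed
  have "finite (maximal_elements S)" using S by (simp add: maximal_elements_def)
  then have "card ?D = (\<Sum>c\<in>maximal_elements S. num_ext (S - {c}))"
    using S by (simp add: finite_linear_extensions num_ext_def)
  then show ?thesis
    using card_image[OF inj] im by (simp add: num_ext_def)
qed

lemma num_ext_ge_sum:
  assumes "finite S" "S \<noteq> {}" "C \<subseteq> maximal_elements S"
  shows "(\<Sum>c\<in>C. num_ext (S - {c})) \<le> num_ext S"
  unfolding num_ext_branching[OF assms(1,2)]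
  by (rule sum_mono2) (use assms in \<open>auto simp: maximal_elements_def\<close>)

lemma maximal_above:
  assumes "finite S" "x \<in> S"
  obtains c where "c \<in> maximal_elements S" "x \<le> c"
  using finite_has_maximal2[OF assms] unfolding maximal_elements_def by fastforce

lemma num_ext_pos: "finite S \<Longrightarrow> 1 \<le> num_ext S"
proof (induction "card S" arbitrary: S)
  case 0
  then show ?case by (simp add: num_ext_empty)
next
  case (Suc k)
  then have "S \<noteq> {}" by auto
  then obtain c where c: "c \<in> maximal_elements S" using maximal_above[OF Suc.prems] by blast
  then have "c \<in> S" by (simp add: maximal_elements_def)
  then have "1 \<le> num_ext (S - {c})" using Suc by simp
  also have "\<dots> \<le> num_ext S" using num_ext_ge_sum[of S "{c}"] c Suc \<open>S \<noteq> {}\<close> by simp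
  finally show ?case .
qed

text \<open>
  Used to transpose diagrams.
\<close>

lemma num_ext_order_iso:
  fixes f :: "'a::order \<Rightarrow> 'b::order"
  assumes "\<And>x y. f x \<le> f y \<longleftrightarrow> x \<le> y" "finite S"
  shows "num_ext (f ` S) = num_ext S"
  using assms(2)
proof (induction "card S" arbitrary: S)
  case 0
  then show ?case by (simp add: num_ext_empty)
next
  case (Suc k)
  have inj: "inj f" using assms(1) by (metis injI order_antisym order_refl)
  have mx: "maximal_elements (f ` S) = f ` maximal_elements S"
  proof -
    have "f c \<in> maximal_elements (f ` S) \<longleftrightarrow> c \<in> maximal_elements S" if "c \<in> S" for c
      using that inj by (simp add: maximal_elements_def assms(1) inj_eq)
    then show ?thesis by (auto simp: maximal_elements_def)
  qed
  have "S \<noteq> {}" using Suc.hyps(2) by auto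
  then have "num_ext (f ` S) = (\<Sum>c\<in>f ` maximal_elements S. num_ext (f ` S - {c}))"
    using Suc.prems by (subst num_ext_branching) (simp_all add: mx)
  also have "\<dots> = (\<Sum>c\<in>maximal_elements S. num_ext (f ` S - {f c}))"
    using inj by (subst sum.reindex) (auto intro: inj_on_subset)
  also have "\<dots> = (\<Sum>c\<in>maximal_elements S. num_ext (S - {c}))"
  proof (rule sum.cong)
    fix c assume "c \<in> maximal_elements S"
    then have "c \<in> S" by (simp add: maximal_elements_def)
    then have "num_ext (f ` (S - {c})) = num_ext (S - {c})"
      using Suc.hyps(2) Suc.prems by (intro Suc.hyps(1)) auto
    moreover have "f ` S - {f c} = f ` (S - {c})" using inj by (auto dest: injD)
    ultimately show "num_ext (f ` S - {f c}) = num_ext (S - {c})" by simp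
  qed simp
  also have "\<dots> = num_ext S" using num_ext_branching[OF Suc.prems \<open>S \<noteq> {}\<close>] by simp
  finally show ?case .
qed

section \<open>Young diagrams and opposite hooks\<close>

definition young_diagram :: "(nat \<times> nat) set \<Rightarrow> bool" where
  "young_diagram S \<longleftrightarrow> finite S \<and> (\<forall>(a, b)\<in>S. 1 \<le> a \<and> 1 \<le> b) \<and>
    (\<forall>a b a' b'. (a, b) \<in> S \<and> 1 \<le> a' \<and> a' \<le> a \<and> 1 \<le> b' \<and> b' \<le> b \<longrightarrow> (a', b') \<in> S)"

lemma young_diagram_finite: "young_diagram S \<Longrightarrow> finite S"
  by (simp add: young_diagram_def)

lemma young_diagram_pos: "young_diagram S \<Longrightarrow> (a, b) \<in> S \<Longrightarrow> 1 \<le> a \<and> 1 \<le> b"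
  by (auto simp: young_diagram_def)

lemma young_diagram_below:
  "young_diagram S \<Longrightarrow> (a, b) \<in> S \<Longrightarrow> 1 \<le> a' \<Longrightarrow> a' \<le> a \<Longrightarrow> 1 \<le> b' \<Longrightarrow> b' \<le> b \<Longrightarrow> (a', b') \<in> S"
  by (fastforce simp: young_diagram_def)

lemma maximal_elements_in: "c \<in> maximal_elements S \<Longrightarrow> c \<in> S"
  by (simp add: maximal_elements_def)

lemma maximal_elementsD: "(a, b) \<in> maximal_elements S \<Longrightarrow> (a', b') \<in> S \<Longrightarrow> a \<le> a' \<Longrightarrow> b \<le> b' \<Longrightarrow> a' = a \<and> b' = b"
  by (fastforce simp: maximal_elements_def)

lemma maximal_elementsI:
  "(a, b) \<in> S \<Longrightarrow> (\<And>a' b'. (a', b') \<in> S \<Longrightarrow> a \<le> a' \<Longrightarrow> b \<le> b' \<Longrightarrow> a' = a \<and> b' = b)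
    \<Longrightarrow> (a, b) \<in> maximal_elements S"
  by (auto simp: maximal_elements_def)

lemma young_diagram_remove:
  assumes "young_diagram S" "c \<in> maximal_elements S"
  shows "young_diagram (S - {c})"
proof -
  have "(a', b') \<noteq> c" if "(a, b) \<in> S - {c}" "a' \<le> a" "b' \<le> b" for a b a' b'
    using that assms(2) maximal_elementsD[of a' b' S a b] by auto
  then show ?thesis
    using assms(1) unfolding young_diagram_def by fast
qed

lemma maximal_of_max_hook:
  assumes "young_diagram S" "c \<in> S" "\<And>d. d \<in> S \<Longrightarrow> op_hook d \<le> op_hook c"
  shows "c \<in> maximal_elements S"
proof -
  obtain a b where c: "c = (a, b)" by force
  show ?thesis unfolding c
  proof (rule maximal_elementsI)
    show "(a, b) \<in> S" using assms c by simp
    fix a' b' assume d: "(a', b') \<in> S" "a \<le> a'" "b \<le> b'"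
    have "1 \<le> a" "1 \<le> b" using young_diagram_pos[OF assms(1)] assms(2) c by auto
    moreover have "a' + b' - 1 \<le> a + b - 1" using assms(3)[OF d(1)] c by (simp add: op_hook_def)
    ultimately show "a' = a \<and> b' = b" using d(2,3) by arith
  qed
qed

lemma op_hook_pos: "young_diagram S \<Longrightarrow> c \<in> S \<Longrightarrow> 1 \<le> op_hook c"
  using young_diagram_pos[of S "fst c" "snd c"] by (auto simp: op_hook_def)

text \<open>
  The cell \<open>(a, b)\<close> is reached from \<open>(1, 1)\<close> by a path of \<open>a + b - 1\<close> cells
  that turns once, and all of them lie in the diagram.
\<close>

lemma op_hook_le_card:
  assumes S: "young_diagram S" "c \<in> S"
  shows "op_hook c \<le> card S"
proof -
  obtain a b where c: "c = (a, b)" by force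
  have ab: "1 \<le> a" "1 \<le> b" using young_diagram_pos[OF S(1)] S(2) c by auto
  let ?A = "{1..a} \<times> {1}" and ?B = "{a} \<times> {2..b}"
  have "?A \<union> ?B \<subseteq> S"
    using young_diagram_below[OF S(1), of a b] S(2) c ab by auto
  moreover have "card (?A \<union> ?B) = a + (b - 1)"
    by (subst card_Un_disjoint) (auto simp: card_cartesian_product)
  ultimately have "a + (b - 1) \<le> card S"
    using card_mono young_diagram_finite[OF S(1)] by metis
  then show ?thesis using c ab by (simp add: op_hook_def)
qed

text \<open>
  Of two distinct cells on the same antidiagonal, one is strictly to the right and strictly in the
  lower row number. Reach the left one by going along column 1 first and the right one by going
  along row 1 first: the two paths meet only in \<open>(1, 1)\<close>, so together they have
  $2h - 1$ cells.
\<close>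

lemma two_equal_hooks:
  assumes S: "young_diagram S" "c \<in> S" "d \<in> S" and "c \<noteq> d" "op_hook c = op_hook d"
  shows "2 * op_hook c \<le> card S + 1"
  using assms(2-5)
proof (induction "fst c" "fst d" arbitrary: c d rule: linorder_wlog)
  case (sym c d)
  then show ?case by metis
next
  case (le c d)
  obtain a b a' b' where c: "c = (a, b)" "d = (a', b')" by force
  have pos: "1 \<le> a" "1 \<le> b" "1 \<le> a'" "1 \<le> b'"
    using young_diagram_pos[OF S(1)] le c by auto
  have less: "a < a'" "b' < b"
    using le c pos by (auto simp: op_hook_def)
  \<comment> \<open>The path to \<open>c\<close> is \<open>?A \<union> ?B\<close>; the path to \<open>d\<close>, without the common cell \<open>(1, 1)\<close>, is \<open>?C \<union> ?D\<close>.\<close>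
  let ?A = "{1} \<times> {1..b}" and ?B = "{2..a} \<times> {b}" and ?C = "{2..a'} \<times> {1}" and ?D = "{a'} \<times> {2..b'}"
  have "(?A \<union> ?B) \<union> (?C \<union> ?D) \<subseteq> S"
  proof -
    have "(a, b) \<in> S" "(a', b') \<in> S" using le c by auto
    note below = young_diagram_below[OF S(1) this(1)] young_diagram_below[OF S(1) this(2)]
    have "?A \<subseteq> S" "?B \<subseteq> S" using pos by (auto intro!: below(1))
    moreover have "?C \<subseteq> S" "?D \<subseteq> S" using pos by (auto intro!: below(2))
    ultimately show ?thesis by simp
  qed
  moreover have "card ((?A \<union> ?B) \<union> (?C \<union> ?D)) = (b + (a - 1)) + ((a' - 1) + (b' - 1))"
  proof -
    have "card (?A \<union> ?B) = b + (a - 1)"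
      by (subst card_Un_disjoint) (auto simp: card_cartesian_product)
    moreover have "card (?C \<union> ?D) = (a' - 1) + (b' - 1)"
      by (subst card_Un_disjoint) (auto simp: card_cartesian_product)
    moreover have "(?A \<union> ?B) \<inter> (?C \<union> ?D) = {}"
      using less pos by auto
    ultimately show ?thesis by (subst card_Un_disjoint) auto
  qed
  ultimately have "(b + (a - 1)) + ((a' - 1) + (b' - 1)) \<le> card S"
    using card_mono young_diagram_finite[OF S(1)] by metis
  then show ?case using le c pos by (simp add: op_hook_def)
qed

section \<open>Products of opposite hook lengths\<close>

text \<open>
  For a nonempty diagram, admissibility says that \<open>M\<close> is at most the diagonal excess; writing it with a sum
  avoids both the truncated subtraction and the maximum.
\<close>

definition excess_ge :: "(nat \<times> nat) set \<Rightarrow> nat \<Rightarrow> bool" where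
  "excess_ge S M \<longleftrightarrow> (\<forall>c\<in>S. op_hook c + M \<le> card S)"

lemma excess_ge_remove:
  assumes "finite S" "c \<in> S" "excess_ge S M" "M \<noteq> 0"
  shows "excess_ge (S - {c}) (M - 1)"
  unfolding excess_ge_def
proof
  fix d assume "d \<in> S - {c}"
  then have "op_hook d + M \<le> card S" using assms(3) by (simp add: excess_ge_def)
  then show "op_hook d + (M - 1) \<le> card (S - {c})"
    using card.remove[OF assms(1,2)] assms(4) by simp
qed

lemma excess_ge_remove_top:
  assumes "finite S" "c \<in> S" "excess_ge S M"
    and "\<And>d. d \<in> S \<Longrightarrow> d \<noteq> c \<Longrightarrow> op_hook d + M \<noteq> card S"
  shows "excess_ge (S - {c}) M"
  unfolding excess_ge_def
proof
  fix d assume "d \<in> S - {c}"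
  then have "op_hook d + M \<le> card S" "op_hook d + M \<noteq> card S"
    using assms(3,4) by (auto simp: excess_ge_def)
  then show "op_hook d + M \<le> card (S - {c})"
    using card.remove[OF assms(1,2)] by simp
qed

text \<open>
  A cell with the largest hook is removed. Whether another cell forces \<open>M\<close> down to
  \<open>M - 1\<close> decides which of the two factorials absorbs the hook.
\<close>

lemma prod_op_hook_le:
  assumes "young_diagram S" "excess_ge S M"
  shows "(\<Prod>c\<in>S. op_hook c) \<le> fact (card S - M) * fact (M + 1)"
  using assms
proof (induction "card S" arbitrary: S M)
  case 0
  then show ?case using young_diagram_finite[of S] fact_ge_1[of "M + 1", where 'a = nat]
    by (simp del: fact_Suc fact_ge_1)
next
  case (Suc n)
  have fin: "finite S" "S \<noteq> {}" using Suc.hyps(2) Suc.prems young_diagram_finite by auto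
  obtain c where c: "c \<in> S" "\<And>d. d \<in> S \<Longrightarrow> op_hook d \<le> op_hook c"
  proof -
    have "Max (op_hook ` S) \<in> op_hook ` S" using fin by (intro Max_in) auto
    then obtain c where "c \<in> S" "Max (op_hook ` S) = op_hook c" by blast
    then show thesis using that Max_ge[OF finite_imageI[OF fin(1)], of _ op_hook] by fastforce
  qed
  have mx: "c \<in> maximal_elements S" using maximal_of_max_hook Suc.prems(1) c by blast
  have yd: "young_diagram (S - {c})" using young_diagram_remove Suc.prems(1) mx by blast
  have n: "n = card (S - {c})" using card.remove[OF fin(1) c(1)] Suc.hyps(2) by simp
  have hM: "op_hook c + M \<le> Suc n" using Suc.prems(2) c Suc.hyps(2) by (simp add: excess_ge_def)
  have "1 \<le> op_hook c" using op_hook_pos Suc.prems(1) c by blast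
  then have Mn: "M \<le> n" using hM by simp
  have split: "(\<Prod>c\<in>S. op_hook c) = op_hook c * (\<Prod>c\<in>S - {c}. op_hook c)"
    using prod.remove[OF fin(1) c(1)] .
  show ?case
  proof (cases "\<exists>d\<in>S. d \<noteq> c \<and> op_hook d + M = card S")
    case False
    then have "excess_ge (S - {c}) M"
      using excess_ge_remove_top[OF fin(1) c(1) Suc.prems(2)] by blast
    then have IH: "(\<Prod>c\<in>S - {c}. op_hook c) \<le> fact (n - M) * fact (M + 1)"
      using Suc.hyps(1)[OF n yd] n by simp
    have "op_hook c * (\<Prod>c\<in>S - {c}. op_hook c) \<le> (Suc n - M) * (fact (n - M) * fact (M + 1))"
      using hM by (intro mult_le_mono IH) simp
    also have "\<dots> = fact (Suc n - M) * fact (M + 1)"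
    proof -
      have "fact (Suc n - M) = (Suc n - M) * (fact (n - M) :: nat)"
        using Mn by (simp add: Suc_diff_le)
      then show ?thesis by (simp only: mult.assoc)
    qed
    finally show ?thesis using split Suc.hyps(2) by simp
  next
    case True
    then obtain d where d: "d \<in> S" "d \<noteq> c" "op_hook d + M = Suc n" using Suc.hyps(2) by auto
    then have hd: "op_hook c = op_hook d" using c(2)[of d] hM by simp
    then have "2 * op_hook c \<le> Suc n + 1"
      using two_equal_hooks[OF Suc.prems(1) c(1) d(1)] d Suc.hyps(2) by simp
    then have hM1: "op_hook c \<le> M + 1" using d hd by simp
    have "M \<noteq> 0"
    proof
      assume "M = 0"
      then have "n = 0" using hM1 d(3) hd by simp
      then have "S - {c} = {}" using n fin by simp
      then show False using d by auto
    qed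
    then have M1: "M \<ge> 1" by simp
    then have "excess_ge (S - {c}) (M - 1)"
      using excess_ge_remove[OF fin(1) c(1) Suc.prems(2)] by simp
    then have IH: "(\<Prod>c\<in>S - {c}. op_hook c) \<le> fact (n - (M - 1)) * fact (M - 1 + 1)"
      using Suc.hyps(1)[OF n yd] n by simp
    have "op_hook c * (\<Prod>c\<in>S - {c}. op_hook c) \<le> (M + 1) * (fact (n - (M - 1)) * fact (M - 1 + 1))"
      by (intro mult_le_mono IH hM1)
    also have "n - (M - 1) = Suc n - M" using M1 by simp
    also have "M - 1 + 1 = M" using M1 by simp
    finally show ?thesis using split Suc.hyps(2) by (simp add: algebra_simps)
  qed
qed

section \<open>Diagrams with at least two corners\<close>

text \<open>
  The inductive step for diagrams with at least two corners. Here \<open>IH\<close> is the bound for the diagrams with one cell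
  fewer, whose number of cells plus one is \<open>card S\<close>.
\<close>

lemma num_ext_two_maximal:
  assumes S: "young_diagram S" and M: "excess_ge S M"
    and two: "\<And>c. \<exists>c'. c' \<in> maximal_elements S \<and> c' \<noteq> c"
    and IH: "\<And>c M'. c \<in> maximal_elements S \<Longrightarrow> excess_ge (S - {c}) M' \<Longrightarrow>
      card S choose Suc M' \<le> card S * num_ext (S - {c})"
  shows "Suc (card S) choose Suc M \<le> Suc (card S) * num_ext S"
proof (cases "M = 0")
  case True
  then show ?thesis using mult_le_mono2[OF num_ext_pos[OF young_diagram_finite[OF S]], of "Suc (card S)"]
    by simp
next
  case False
  define n where "n = card S"
  note fin = young_diagram_finite[OF S]
  have in_S: "c \<in> S" if "c \<in> maximal_elements S" for c using that by (simp add: maximal_elements_def)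
  have ne: "S \<noteq> {}" using two in_S by blast
  then have n: "1 \<le> n" using fin by (simp add: n_def Suc_le_eq card_gt_0_iff)
  have below: "n choose M \<le> n * num_ext (S - {c})" if "c \<in> maximal_elements S" for c
  proof -
    have "excess_ge (S - {c}) (M - 1)"
      using excess_ge_remove[OF fin in_S[OF that] M False] .
    then show ?thesis using IH[OF that, of "M - 1"] False by (simp add: n_def)
  qed
  have sum: "num_ext (S - {c}) + num_ext (S - {d}) \<le> num_ext S"
    if "c \<in> maximal_elements S" "d \<in> maximal_elements S" "c \<noteq> d" for c d
    using num_ext_ge_sum[OF fin ne, of "{c, d}"] that by simp
  show ?thesis
  proof (cases "\<exists>c\<in>maximal_elements S. \<forall>d\<in>S. d \<noteq> c \<longrightarrow> op_hook d + M \<noteq> n")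
    case True
    then obtain c where c: "c \<in> maximal_elements S"
      "\<And>d. d \<in> S \<Longrightarrow> d \<noteq> c \<Longrightarrow> op_hook d + M \<noteq> n" by blast
    \<comment> \<open>Removing \<open>c\<close> keeps \<open>M\<close> admissible, removing any other corner keeps \<open>M - 1\<close>: Pascal's rule applies.\<close>
    then have "excess_ge (S - {c}) M"
      using excess_ge_remove_top[OF fin in_S M] by (simp add: n_def)
    then have 1: "n choose Suc M \<le> n * num_ext (S - {c})"
      using IH c(1) by (simp add: n_def)
    obtain d where d: "d \<in> maximal_elements S" "d \<noteq> c" using two by blast
    have "Suc n choose Suc M \<le> n * num_ext (S - {c}) + n * num_ext (S - {d})"
      using 1 below[OF d(1)] by simp
    also have "\<dots> \<le> n * num_ext S"
      using sum[of c d] c d by (simp flip: distrib_left)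
    also have "\<dots> \<le> Suc n * num_ext S" by simp
    finally show ?thesis by (simp add: n_def)
  next
    case False
    \<comment> \<open>Whichever corner is removed, another cell attains \<open>n - M\<close>. Hence two corners attain it; each
    removal only keeps \<open>M - 1\<close>, and \<open>n \<le> 2 * (M + 1)\<close> compensates for that.\<close>
    have top: "d \<in> maximal_elements S" if "d \<in> S" "op_hook d + M = n" for d
    proof (rule maximal_of_max_hook[OF S that(1)])
      fix e assume "e \<in> S"
      then show "op_hook e \<le> op_hook d" using M that by (fastforce simp: excess_ge_def n_def)
    qed
    obtain c where "c \<in> maximal_elements S" using two by blast
    then obtain d where d: "d \<in> S" "op_hook d + M = n" using False by blast
    then obtain e where e: "e \<in> S" "e \<noteq> d" "op_hook e + M = n" using False top by blast
    have "2 * op_hook d \<le> n + 1"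
      using two_equal_hooks[OF S d(1) e(1)] d e by (simp add: n_def)
    then have nM: "n \<le> 2 * (M + 1)" using d by simp
    have "2 * (n choose M) \<le> n * num_ext (S - {d}) + n * num_ext (S - {e})"
      using below[OF top[OF d]] below[OF top[OF e(1,3)]] by simp
    also have "\<dots> \<le> n * num_ext S"
      using sum[OF top[OF d] top[OF e(1,3)]] e by (simp flip: distrib_left)
    finally have 2: "2 * (n choose M) \<le> n * num_ext S" .
    have "n * (Suc M * (Suc n choose Suc M)) = n * (Suc n * (n choose M))"
      by (simp only: Suc_times_binomial_eq mult.commute)
    also have "\<dots> \<le> (2 * (M + 1)) * (Suc n * (n choose M))"
      using nM by (rule mult_right_mono) simp
    also have "\<dots> = Suc M * Suc n * (2 * (n choose M))" by (simp add: algebra_simps)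
    also have "\<dots> \<le> Suc M * Suc n * (n * num_ext S)" using 2 by (rule mult_left_mono) simp
    also have "\<dots> = (n * Suc M) * (Suc n * num_ext S)" by (simp add: algebra_simps)
    finally have "(n * Suc M) * (Suc n choose Suc M) \<le> (n * Suc M) * (Suc n * num_ext S)"
      by (simp only: mult.assoc)
    then show ?thesis using n by (simp add: n_def)
  qed
qed

section \<open>Ballot numbers and middle binomial coefficients\<close>

text \<open>
  The number of standard tableaux with two rows, of lengths \<open>i\<close> and \<open>j\<close>; zero if \<open>i < j\<close>. On the
  diagonal these are the Catalan numbers.
\<close>

fun ballot :: "nat \<Rightarrow> nat \<Rightarrow> nat" where
  "ballot i 0 = 1"
| "ballot 0 (Suc j) = 0"
| "ballot (Suc i) (Suc j) = (if i < j then 0 else ballot i (Suc j) + ballot (Suc i) j)"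

lemma ballot_eq_0: "i < j \<Longrightarrow> ballot i j = 0"
  by (cases "(i, j)" rule: ballot.cases) auto

lemma ballot_mono: "ballot i j \<le> ballot (Suc i) j"
  by (cases j) (auto simp: ballot_eq_0)

text \<open>
  The reflection-principle value of the ballot numbers, with the division cleared. The case
  \<open>j = i + 1\<close>, where both sides vanish, is included since the recursion runs through it.
\<close>

lemma ballot_closed: "j \<le> Suc i \<Longrightarrow> Suc i * ballot i j = (Suc i - j) * ((i + j) choose j)"
proof (induction i j rule: ballot.induct)
  case (3 i j)
  show ?case
  proof (cases "i < j")
    case True
    then show ?thesis using 3 by simp
  next
    case False
    then obtain d where i: "i = j + d" by (metis le_add_diff_inverse not_less)
    define X where "X = (i + Suc j) choose Suc j"
    define Y where "Y = (Suc i + j) choose j"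
    have IH1: "Suc i * ballot i (Suc j) = d * X" and IH2: "Suc (Suc i) * ballot (Suc i) j = (d + 2) * Y"
      using 3(1,2) False i by (simp_all add: X_def Y_def)
    have XY: "Suc j * X = Suc i * Y"
    proof -
      have "Suc i * Y = Suc (i + j) * ((i + j) choose j)"
        using binomial_absorb_comp[of "Suc (i + j)" j] by (simp add: Y_def)
      also have "\<dots> = Suc j * X"
        unfolding X_def Suc_times_binomial_eq by (simp only: add_Suc_right mult.commute)
      finally show ?thesis by simp
    qed
    have "(Suc i + Suc j) choose Suc j = X + Y" by (simp add: X_def Y_def)
    have "Suc i * (Suc (Suc i) * (ballot i (Suc j) + ballot (Suc i) j)) =
        Suc (Suc i) * (Suc i * ballot i (Suc j)) + Suc i * (Suc (Suc i) * ballot (Suc i) j)"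
      by (simp only: algebra_simps)
    also have "\<dots> = Suc (Suc i) * (d * X) + Suc i * ((d + 2) * Y)" by (simp only: IH1 IH2)
    also have "\<dots> = Suc i * ((d + 1) * (X + Y))"
    proof -
      have "int (Suc j * X) = int (Suc i * Y)" using XY by simp
      then have "int (Suc (Suc i) * (d * X) + Suc i * ((d + 2) * Y)) = int (Suc i * ((d + 1) * (X + Y)))"
        unfolding i by (simp add: algebra_simps)
      then show ?thesis by (simp only: of_nat_eq_iff)
    qed
    finally have "Suc (Suc i) * (ballot i (Suc j) + ballot (Suc i) j) = (d + 1) * (X + Y)"
      by (simp only: mult_cancel1) simp
    then show ?thesis using False i by (simp add: X_def Y_def)
  qed
qed simp_all

text \<open>
  From $C_1$ on, each Catalan number is at least twice its predecessor, and $C_5 = 42$.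
\<close>

lemma two_power_le_catalan: "5 \<le> p \<Longrightarrow> 2 ^ p \<le> ballot p p"
proof (induction p rule: dec_induct)
  case base
  show ?case by (simp add: eval_nat_numeral)
next
  case (step p)
  then obtain r where p: "p = Suc r" by (cases p) auto
  have "ballot p p = ballot p r" unfolding p by (simp add: ballot_eq_0)
  then have "2 * ballot p p \<le> ballot p p + ballot (Suc p) r" using ballot_mono[of p r] by simp
  also have "\<dots> = ballot (Suc p) p" unfolding p by (simp add: ballot_eq_0)
  also have "\<dots> = ballot (Suc p) (Suc p)" by (simp add: ballot_eq_0)
  finally show ?case using step by simp
qed

definition middle_binomial :: "nat \<Rightarrow> nat" where "middle_binomial k = k choose (k div 2)"

lemma middle_binomial_add: "middle_binomial (k + j) \<le> 2 ^ j * middle_binomial k"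
proof (induction j)
  case (Suc j)
  have "middle_binomial (Suc m) \<le> 2 * middle_binomial m" for m
  proof (cases "Suc m div 2")
    case (Suc l)
    then have "middle_binomial (Suc m) = (m choose l) + (m choose Suc l)" by (simp add: middle_binomial_def)
    then show ?thesis using binomial_maximum[of m l] binomial_maximum[of m "Suc l"]
      by (simp add: middle_binomial_def)
  next
    case 0
    then show ?thesis by (simp add: middle_binomial_def)
  qed
  from this[of "k + j"] Suc show ?case by simp
qed simp

section \<open>Adding a row\<close>

text \<open>
  Attaching a row of length \<open>j\<close> below a last row of length \<open>i\<close> multiplies the number of linear extensions
  by at least the number of two-row tableaux with rows \<open>i\<close> and \<open>j\<close>. Branching on the corners proves it: corners above
  row \<open>r\<close> are common to both diagrams, and the corners that end the last two rows of the larger diagram match the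
  recursion of the ballot numbers. In the term for \<open>ballot i (j - 1)\<close> the larger diagram loses the end of the new row,
  while \<open>S\<close> loses the end of row \<open>r\<close>; there it suffices that \<open>S\<close> has at least as many linear extensions
  as \<open>S\<close> without that cell.
\<close>

lemma num_ext_add_row:
  assumes "young_diagram S" "\<And>c. c \<in> S \<Longrightarrow> snd c \<le> r" "\<And>a. (a, r) \<in> S \<longleftrightarrow> 1 \<le> a \<and> a \<le> i"
    and "j \<le> i" "1 \<le> r"
  shows "ballot i j * num_ext S \<le> num_ext (S \<union> {1..j} \<times> {Suc r})"
  using assms
proof (induction "card S + j" arbitrary: S i j rule: less_induct)
  case less
  note S = \<open>young_diagram S\<close> and rows = less.prems(2) and row = less.prems(3)
  note fin = young_diagram_finite[OF S]
  show ?case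
  proof (cases j)
    case 0
    then show ?thesis by simp
  next
    case (Suc k)
    then obtain l where i: "i = Suc l" using less.prems(4) by (cases i) auto
    define A where "A = (\<lambda>S j. S \<union> {1..j} \<times> {Suc r} :: (nat \<times> nat) set)"
    have finA: "finite (A S j)" "A S j \<noteq> {}" using fin Suc by (auto simp: A_def)
    have end_in: "(i, r) \<in> S" using row i by simp
    have end_max: "(i, r) \<in> maximal_elements S"
      using end_in rows row by (intro maximal_elementsI) fastforce+
    \<comment> \<open>\<open>C\<close> is the set of corners of \<open>S\<close> in the rows above \<open>r\<close>.\<close>
    define C where "C = maximal_elements S - {(i, r)}"
    have C: "snd c < r" "c \<in> S" "c \<in> maximal_elements S" if "c \<in> C" for c
    proof -
      show 1: "c \<in> maximal_elements S" "c \<in> S" using that by (auto simp: C_def maximal_elements_in)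
      obtain a b where c: "c = (a, b)" by force
      have "b \<noteq> r"
      proof
        assume "b = r"
        then have "a \<le> i" using row[of a] 1 c by simp
        then show False using maximal_elementsD[of a b S i r] 1 c end_in \<open>b = r\<close> that
          by (auto simp: C_def)
      qed
      then show "snd c < r" using rows[OF 1(2)] c by simp
    qed
    have C_max: "c \<in> maximal_elements (A S j)" if "c \<in> C" for c
    proof -
      obtain a b where c: "c = (a, b)" by force
      note cC = C[OF that]
      have "a' = a \<and> b' = b" if d: "(a', b') \<in> A S j" "a \<le> a'" "b \<le> b'" for a' b'
      proof (cases "(a', b') \<in> S")
        case True
        then show ?thesis using maximal_elementsD[of a b S a' b'] cC c d by simp
      next
        case False
        then have "a' \<le> i" using d less.prems(4) by (auto simp: A_def)
        moreover have "1 \<le> a" using young_diagram_pos[OF S] cC c by auto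
        ultimately have "(a, r) \<in> S" using row d by simp
        then show ?thesis using maximal_elementsD[of a b S a r] cC c by auto
      qed
      moreover have "(a, b) \<in> A S j" using cC c by (simp add: A_def)
      ultimately show ?thesis unfolding c by (intro maximal_elementsI) auto
    qed
    have new_max: "(j, Suc r) \<in> maximal_elements (A S j)"
      using rows Suc by (intro maximal_elementsI) (fastforce simp: A_def)+
    have A_remove: "A S j - {c} = A (S - {c}) j" if "c \<in> S" for c
      using that rows by (fastforce simp: A_def)
    have A_new: "A S j - {(j, Suc r)} = A S k"
      using rows Suc by (fastforce simp: A_def)
    have new_notin: "(j, Suc r) \<notin> C" using C(1)[of "(j, Suc r)"] by auto
    have finC: "finite C" using fin by (simp add: C_def maximal_elements_def)
    have IH_C: "ballot i j * num_ext (S - {c}) \<le> num_ext (A (S - {c}) j)" if "c \<in> C" for c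
      unfolding A_def
    proof (rule less.hyps)
      show "card (S - {c}) + j < card S + j" using card_Diff1_less[OF fin] C[OF that] by simp
      show "young_diagram (S - {c})" using young_diagram_remove[OF S] C[OF that] by simp
      show "(a, r) \<in> S - {c} \<longleftrightarrow> 1 \<le> a \<and> a \<le> i" for a using row C[OF that] by auto
    qed (use rows less.prems(4,5) in auto)
    have IH_new: "ballot i k * num_ext S \<le> num_ext (A S k)"
      unfolding A_def
      by (rule less.hyps) (use less.prems(1,4,5) rows row Suc in simp_all)
    have IH_end: "ballot l j * num_ext (S - {(i, r)}) \<le> num_ext (A (S - {(i, r)}) j)" if "j \<le> l"
      unfolding A_def
    proof (rule less.hyps)
      show "card (S - {(i, r)}) + j < card S + j"
        using card_Diff1_less[OF fin end_in] by simp
      show "young_diagram (S - {(i, r)})" using young_diagram_remove[OF S end_max] .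
      show "(a, r) \<in> S - {(i, r)} \<longleftrightarrow> 1 \<le> a \<and> a \<le> l" for a
        using row[of a] i by auto
      show "snd c \<le> r" if "c \<in> S - {(i, r)}" for c using that rows by blast
    qed (fact that, fact less.prems(5))
    have S_sum: "num_ext S = (\<Sum>c\<in>C. num_ext (S - {c})) + num_ext (S - {(i, r)})"
    proof -
      have "finite (maximal_elements S)" "S \<noteq> {}"
        using fin end_in by (auto simp: maximal_elements_def)
      then show ?thesis
        using num_ext_branching[OF fin]
          sum.remove[OF _ end_max, of "\<lambda>c. num_ext (S - {c})"] by (simp add: C_def)
    qed
    have "num_ext (S - {(i, r)}) \<le> num_ext S" using S_sum by simp
    then have mono: "ballot i k * num_ext (S - {(i, r)}) \<le> num_ext (A S k)"
      using IH_new by (meson le_trans mult_le_mono2)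
    have "ballot i j * num_ext S = (\<Sum>c\<in>C. ballot i j * num_ext (S - {c}))
        + (ballot l j + ballot i k) * num_ext (S - {(i, r)})"
      using less.prems(4) by (simp add: S_sum distrib_left sum_distrib_left Suc i)
    also have "\<dots> \<le> (\<Sum>c\<in>C. num_ext (A S j - {c})) + ballot l j * num_ext (S - {(i, r)})
        + num_ext (A S j - {(j, Suc r)})"
    proof -
      have "(\<Sum>c\<in>C. ballot i j * num_ext (S - {c})) \<le> (\<Sum>c\<in>C. num_ext (A S j - {c}))"
        by (rule sum_mono) (use IH_C A_remove C in auto)
      then show ?thesis using mono A_new by (simp add: distrib_right)
    qed
    also have "\<dots> \<le> num_ext (A S j)"
    \<comment> \<open>The end of row \<open>r\<close> is a corner of the larger diagram only if \<open>j < i\<close>; otherwise its ballot number is 0.\<close>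
    proof (cases "j \<le> l")
      case True
      have "(i, r) \<in> maximal_elements (A S j)"
      proof (rule maximal_elementsI)
        fix a' b' assume d: "(a', b') \<in> A S j" "i \<le> a'" "r \<le> b'"
        then have "(a', b') \<in> S" using True i by (auto simp: A_def)
        then show "a' = i \<and> b' = r" using maximal_elementsD[OF end_max] d by blast
      qed (use end_in in \<open>simp add: A_def\<close>)
      then have "(\<Sum>c\<in>insert (j, Suc r) (insert (i, r) C). num_ext (A S j - {c})) \<le> num_ext (A S j)"
        using C_max new_max by (intro num_ext_ge_sum finA) auto
      moreover have "(j, Suc r) \<notin> insert (i, r) C" "(i, r) \<notin> C"
        using new_notin by (auto simp: C_def)
      ultimately show ?thesis using finC IH_end[OF True] A_remove[OF end_in] by simp
    next
      case False
      then have "ballot l j = 0" by (simp add: ballot_eq_0)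
      moreover have "(\<Sum>c\<in>insert (j, Suc r) C. num_ext (A S j - {c})) \<le> num_ext (A S j)"
        using C_max new_max by (intro num_ext_ge_sum finA) auto
      ultimately show ?thesis using finC new_notin by simp
    qed
    finally show ?thesis by (simp add: A_def)
  qed
qed

section \<open>Rectangles\<close>

definition rectangle :: "nat \<Rightarrow> nat \<Rightarrow> (nat \<times> nat) set" where
  "rectangle p q = {1..p} \<times> {1..q}"

lemma young_diagram_rectangle: "young_diagram (rectangle p q)"
  by (auto simp: young_diagram_def rectangle_def)

lemma card_rectangle [simp]: "card (rectangle p q) = p * q"
  by (simp add: rectangle_def card_cartesian_product)

text \<open>
  Every cell lies below some corner.
\<close>

lemma rectangle_if_single_maximal:
  assumes S: "young_diagram S" and "maximal_elements S = {(p, q)}"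
  shows "S = rectangle p q"
proof
  have pq: "(p, q) \<in> S" using assms(2) maximal_elements_in by blast
  show "S \<subseteq> rectangle p q"
  proof
    fix c assume c: "c \<in> S"
    then obtain d where "d \<in> maximal_elements S" "c \<le> d"
      using maximal_above[OF young_diagram_finite[OF S]] by blast
    then show "c \<in> rectangle p q"
      using assms young_diagram_pos[OF S, of "fst c" "snd c"] c by (cases c) (auto simp: rectangle_def)
  qed
  show "rectangle p q \<subseteq> S"
    using young_diagram_below[OF S pq] by (auto simp: rectangle_def)
qed

lemma num_ext_swap: "finite S \<Longrightarrow> num_ext (prod.swap ` S) = num_ext (S :: (nat \<times> nat) set)"
  by (rule num_ext_order_iso) auto

lemma num_ext_rectangle_swap: "num_ext (rectangle q p) = num_ext (rectangle p q)"
proof -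
  have "rectangle q p = prod.swap ` rectangle p q" by (simp add: rectangle_def product_swap)
  then show ?thesis using num_ext_swap[of "rectangle p q"] young_diagram_finite[OF young_diagram_rectangle] by simp
qed

lemma num_ext_rectangle_add_row:
  assumes "1 \<le> p" "1 \<le> q" "j \<le> p"
  shows "ballot p j * num_ext (rectangle p q) \<le> num_ext (rectangle p q \<union> {1..j} \<times> {Suc q})"
  by (rule num_ext_add_row) (use assms young_diagram_rectangle in \<open>auto simp: rectangle_def\<close>)

lemma num_ext_rectangle_Suc:
  assumes "1 \<le> p" "1 \<le> q"
  shows "ballot p p * num_ext (rectangle p q) \<le> num_ext (rectangle p (Suc q))"
proof -
  have "rectangle p q \<union> {1..p} \<times> {Suc q} = rectangle p (Suc q)" by (auto simp: rectangle_def)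
  then show ?thesis using num_ext_rectangle_add_row[OF assms, of p] by simp
qed

text \<open>
  The row added to a single row of length \<open>p\<close> yields the Catalan number $C_p$, and
  $(2p+1)\,C_p = \binom{2p+1}{p}$, which is exactly the number required.
\<close>

lemma middle_binomial_le_rectangle_2:
  assumes "1 \<le> p"
  shows "middle_binomial (Suc (p * 2)) \<le> Suc (p * 2) * num_ext (rectangle p 2)"
proof -
  have "ballot p p * 1 \<le> ballot p p * num_ext (rectangle p 1)"
    by (intro mult_le_mono2 num_ext_pos young_diagram_finite young_diagram_rectangle)
  also have "\<dots> \<le> num_ext (rectangle p 2)"
    using num_ext_rectangle_Suc[OF assms, of 1] by (simp add: numeral_2_eq_2)
  finally have le: "ballot p p \<le> num_ext (rectangle p 2)" by simp
  have "Suc p * (Suc (p * 2) choose p) = Suc (2 * p) * (2 * p choose p)"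
    using binomial_absorb_comp[of "Suc (2 * p)" p] by (simp add: mult.commute)
  also have "2 * p choose p = Suc p * ballot p p"
    using ballot_closed[of p p] by (simp add: mult_2)
  finally have "Suc p * (Suc (p * 2) choose p) = Suc p * (Suc (p * 2) * ballot p p)"
    by (simp add: algebra_simps)
  then have "Suc (p * 2) choose p = Suc (p * 2) * ballot p p" by (simp only: mult_cancel1) simp
  moreover have "Suc (p * 2) div 2 = p" by simp
  ultimately have "middle_binomial (Suc (p * 2)) = Suc (p * 2) * ballot p p" by (simp only: middle_binomial_def)
  then show ?thesis using mult_le_mono2[OF le, of "Suc (p * 2)"] by simp
qed

text \<open>
  One more row gains the factor $C_p \<ge> 2^p$ and costs $p$ doublings of the middle binomial
  coefficient.
\<close>

lemma middle_binomial_le_wide_rectangle: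
  assumes "5 \<le> p" "2 \<le> q"
  shows "middle_binomial (Suc (p * q)) \<le> Suc (p * q) * num_ext (rectangle p q)"
  using assms(2)
proof (induction q rule: dec_induct)
  case base
  then show ?case using middle_binomial_le_rectangle_2 assms(1) by simp
next
  case (step q)
  have "middle_binomial (Suc (p * Suc q)) = middle_binomial (Suc (p * q) + p)" by (simp add: add.commute)
  also have "\<dots> \<le> 2 ^ p * middle_binomial (Suc (p * q))" by (rule middle_binomial_add)
  also have "\<dots> \<le> ballot p p * (Suc (p * q) * num_ext (rectangle p q))"
    using two_power_le_catalan[OF assms(1)] step by (intro mult_le_mono) auto
  also have "\<dots> = Suc (p * q) * (ballot p p * num_ext (rectangle p q))" by (simp only: mult.left_commute)
  also have "\<dots> \<le> Suc (p * Suc q) * num_ext (rectangle p (Suc q))"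
    using step assms(1) by (intro mult_le_mono num_ext_rectangle_Suc) auto
  finally show ?case .
qed

lemma catalan_3: "ballot 3 3 = 5" and catalan_4: "ballot 4 4 = 14" and ballot_3_1: "ballot 3 (Suc 0) = 3"
  by (simp_all add: eval_nat_numeral)

text \<open>
  The factor $C_3 = 5$ only gives 25, which is too small: the bound needs $10 f \<ge> 252$. Removing two
  cells from the square leaves the shape with rows 3, 3, 1 or its transpose, each with at least
  $3 \cdot 5$ linear extensions.
\<close>

lemma num_ext_rectangle_3_3: "30 \<le> num_ext (rectangle 3 3)"
proof -
  define L where "L = rectangle 3 2 \<union> {1..1} \<times> {Suc 2}"
  have "ballot 3 3 * num_ext (rectangle 3 1) \<le> num_ext (rectangle 3 2)"
    using num_ext_rectangle_Suc[of 3 1] by (simp add: numeral_2_eq_2)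
  moreover have "1 \<le> num_ext (rectangle 3 1)"
    by (intro num_ext_pos young_diagram_finite young_diagram_rectangle)
  moreover have "ballot 3 1 * num_ext (rectangle 3 2) \<le> num_ext L"
    unfolding L_def by (rule num_ext_rectangle_add_row) simp_all
  ultimately have L: "15 \<le> num_ext L" by (simp add: catalan_3 ballot_3_1)
  have fin: "finite (rectangle 3 3)" by (intro young_diagram_finite young_diagram_rectangle)
  let ?R = "rectangle 3 3 - {(3, 3)}"
  have 1: "?R - {(2, 3)} = L" by (auto simp: rectangle_def L_def)
  have 2: "?R - {(3, 2)} = prod.swap ` L" 
    by (auto simp: rectangle_def L_def image_iff)
  have "(3, 3) \<in> maximal_elements (rectangle 3 3)" by (intro maximal_elementsI) (auto simp: rectangle_def)
  then have "num_ext ?R \<le> num_ext (rectangle 3 3)"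
    using num_ext_ge_sum[OF fin, of "{(3, 3)}"] by (auto simp: maximal_elements_def)
  moreover have "{(2, 3), (3, 2)} \<subseteq> maximal_elements ?R"
    by (auto simp: rectangle_def intro!: maximal_elementsI)
  then have "num_ext (?R - {(2, 3)}) + num_ext (?R - {(3, 2)}) \<le> num_ext ?R"
    using num_ext_ge_sum[of ?R "{(2, 3), (3, 2)}"] fin maximal_elements_in by fastforce
  moreover have "finite L" by (simp add: L_def rectangle_def)
  ultimately show ?thesis using L num_ext_swap[of L] unfolding 1 2 by simp
qed

lemma middle_binomial_le_rectangle_small:
  "middle_binomial 10 \<le> 10 * num_ext (rectangle 3 3)" "middle_binomial 13 \<le> 13 * num_ext (rectangle 4 3)"
  "middle_binomial 17 \<le> 17 * num_ext (rectangle 4 4)"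
proof -
  have c: "middle_binomial 10 = 252" "middle_binomial 13 = 1716" "middle_binomial 17 = 24310"
    by (simp_all add: middle_binomial_def binomial_fact' fact_numeral)
  show "middle_binomial 10 \<le> 10 * num_ext (rectangle 3 3)" using num_ext_rectangle_3_3 c by simp
  have "ballot 4 4 * num_ext (rectangle 4 1) \<le> num_ext (rectangle 4 2)"
    using num_ext_rectangle_Suc[of 4 1] by (simp add: numeral_2_eq_2)
  moreover have "1 \<le> num_ext (rectangle 4 1)"
    by (intro num_ext_pos young_diagram_finite young_diagram_rectangle)
  moreover have "ballot 4 4 * num_ext (rectangle 4 2) \<le> num_ext (rectangle 4 3)"
    using num_ext_rectangle_Suc[of 4 2] by simp
  moreover have "ballot 4 4 * num_ext (rectangle 4 3) \<le> num_ext (rectangle 4 4)"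
    using num_ext_rectangle_Suc[of 4 3] by simp
  ultimately show "middle_binomial 13 \<le> 13 * num_ext (rectangle 4 3)" "middle_binomial 17 \<le> 17 * num_ext (rectangle 4 4)"
    using c by (simp_all add: catalan_4)
qed

lemma middle_binomial_le_rectangle:
  assumes "2 \<le> p" "2 \<le> q"
  shows "middle_binomial (Suc (p * q)) \<le> Suc (p * q) * num_ext (rectangle p q)"
  using assms
proof (induction q p rule: linorder_wlog)
  case (sym q p)
  then show ?case using num_ext_rectangle_swap[of p q] by (simp add: mult.commute)
next
  case (le q p)
  show ?case
  proof (cases "q = 2 \<or> 5 \<le> p")
    case True
    then show ?thesis using le middle_binomial_le_rectangle_2[of p] middle_binomial_le_wide_rectangle[of p q] by auto
  next
    case False
    then have "(p, q) = (3, 3) \<or> (p, q) = (4, 3) \<or> (p, q) = (4, 4)" using le by auto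
    then show ?thesis using middle_binomial_le_rectangle_small by auto
  qed
qed

section \<open>The bound for all diagrams\<close>

text \<open>
  Writing the bound $\binom{n}{M}/(M+1)$ as $\binom{n+1}{M+1}/(n+1)$ makes the step
  with two corners an instance of Pascal's rule.
\<close>

lemma num_ext_lower_bound:
  assumes "young_diagram S" "S \<noteq> {}" "excess_ge S M"
  shows "Suc (card S) choose Suc M \<le> Suc (card S) * num_ext S"
  using assms
proof (induction "card S" arbitrary: S M)
  case 0
  then have "finite S" by (intro young_diagram_finite)
  then show ?case using 0 by simp
next
  case (Suc n)
  note S = Suc.prems(1) and fin = young_diagram_finite[OF Suc.prems(1)]
  obtain c where c: "c \<in> maximal_elements S" using maximal_above[OF fin] Suc.prems(2) by blast
  show ?case
  proof (cases "maximal_elements S = {c}")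
    case False
    show ?thesis
    proof (rule num_ext_two_maximal[OF S Suc.prems(3)])
      show "\<exists>d. d \<in> maximal_elements S \<and> d \<noteq> e" for e using False c by blast
      fix d M' assume d: "d \<in> maximal_elements S" and M': "excess_ge (S - {d}) M'"
      have "d \<in> S" using d by (rule maximal_elements_in)
      then have card: "card S = Suc (card (S - {d}))" using card.remove[OF fin] by blast
      have "S - {d} \<noteq> {}" using False c maximal_elements_in d by blast
      then have "Suc (card (S - {d})) choose Suc M' \<le> Suc (card (S - {d})) * num_ext (S - {d})"
        using Suc.hyps card young_diagram_remove[OF S d] M' by simp
      then show "card S choose Suc M' \<le> card S * num_ext (S - {d})" by (simp only: card)
    qed
  next
    case True
    obtain p q where pq: "c = (p, q)" by force
    have rectangle: "S = rectangle p q" using rectangle_if_single_maximal[OF S] True pq by simp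
    have pos: "1 \<le> p" "1 \<le> q"
      using young_diagram_pos[OF S, of p q] maximal_elements_in[OF c] pq by auto
    show ?thesis
    proof (cases "2 \<le> p \<and> 2 \<le> q")
      case True
      have "Suc (card S) choose Suc M \<le> middle_binomial (Suc (card S))"
        unfolding middle_binomial_def by (rule binomial_maximum)
      then show ?thesis using middle_binomial_le_rectangle[of p q] True rectangle by simp
    next
      case False
      \<comment> \<open>In a single row or column the corner has hook \<open>card S\<close>, which leaves only \<open>M = 0\<close>.\<close>
      then have "p = 1 \<or> q = 1" using pos by auto
      moreover have "op_hook (p, q) + M \<le> p * q"
        using Suc.prems(3) maximal_elements_in[OF c] pq rectangle by (simp add: excess_ge_def)
      ultimately have "M = 0" using pos by (auto simp: op_hook_def)
      then show ?thesis using mult_le_mono2[OF num_ext_pos[OF fin], of "Suc (card S)"] by simp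
    qed
  qed
qed

section \<open>Partitions and standard tableaux\<close>

lemma cells_eq_UN: "cells lam = (\<Union>b<length lam. {1..lam ! b} \<times> {Suc b})"
proof -
  have "(a, b) \<in> cells lam \<longleftrightarrow> (\<exists>i<length lam. a \<in> {1..lam ! i} \<and> b = Suc i)" for a b
    by (cases b) (auto simp: cells_def)
  then show ?thesis by auto
qed

lemma card_cells: "card (cells lam) = sum_list lam"
proof -
  have "card (cells lam) = (\<Sum>b<length lam. card ({1..lam ! b} \<times> {Suc b}))"
    unfolding cells_eq_UN by (rule card_UN_disjoint) auto
  then show ?thesis by (simp add: card_cartesian_product sum_list_sum_nth atLeast0LessThan)
qed

lemma young_diagram_cells:
  assumes "sorted_wrt (\<ge>) lam"
  shows "young_diagram (cells lam)"
proof -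
  have "finite (cells lam)" unfolding cells_eq_UN by auto
  moreover have "(a', b') \<in> cells lam"
    if "(a, b) \<in> cells lam" "1 \<le> a'" "a' \<le> a" "1 \<le> b'" "b' \<le> b" for a b a' b'
  proof -
    have "lam ! (b - 1) \<le> lam ! (b' - 1)"
      using sorted_wrt_nth_less[OF assms, of "b' - 1" "b - 1"] that
      by (cases "b' = b") (auto simp: cells_def)
    then show ?thesis using that by (auto simp: cells_def)
  qed
  moreover have "1 \<le> a \<and> 1 \<le> b" if "(a, b) \<in> cells lam" for a b
    using that by (simp add: cells_def)
  ultimately show ?thesis unfolding young_diagram_def by blast
qed

text \<open>
  Increasing along rows and columns is a special case of strict monotonicity in the
  componentwise order, so linear extensions are standard tableaux.
\<close>

lemma num_ext_le_num_SYT: "num_ext (cells lam) \<le> num_SYT lam"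
proof -
  have "finite (cells lam)" unfolding cells_eq_UN by auto
  have "linear_extensions (cells lam) \<subseteq> standard_tableaux lam"
    by (auto simp: linear_extensions_def standard_tableaux_def card_cells strict_mono_on_def less_le)
  moreover have "finite (standard_tableaux lam)"
    by (rule finite_subset[of _ "cells lam \<rightarrow>\<^sub>E {1..sum_list lam}"])
      (use \<open>finite (cells lam)\<close> in
        \<open>auto simp: standard_tableaux_def bij_betw_def PiE_iff extensional_def intro!: finite_PiE\<close>)
  ultimately show ?thesis by (simp add: num_ext_def num_SYT_def card_mono)
qed

theorem corollary2:
  fixes n M N :: nat and lam :: "nat list"
  assumes "n \<ge> 1"
    and "is_partition lam n"
    and "N = (if 2 * diagonal_excess lam + 1 \<le> n then diagonal_excess lam else (n - 1) div 2)"
    and "M \<le> N"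
  shows "(\<Prod>c\<in>cells lam. op_hook c) \<le> fact (n - M) * fact (M + 1)
    \<and> real (num_SYT lam) \<ge> 1 / (real M + 1) * real (n choose M)"
proof -
  have yd: "young_diagram (cells lam)" and card: "card (cells lam) = n"
    using assms(2) young_diagram_cells by (auto simp: is_partition_def card_cells)
  note fin = young_diagram_finite[OF yd]
  have ne: "cells lam \<noteq> {}" using card assms(1) by auto
  have "M \<le> diagonal_excess lam" using assms(3,4) by (simp split: if_splits)
  then have M: "M \<le> n - Max (op_hook ` cells lam)"
    using assms(2) by (simp add: diagonal_excess_def is_partition_def)
  have "Max (op_hook ` cells lam) \<le> n"
    using fin ne op_hook_le_card[OF yd] card by (subst Max_le_iff) auto
  then have sum: "Max (op_hook ` cells lam) + M \<le> n" using M by simp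
  have excess: "excess_ge (cells lam) M"
    unfolding excess_ge_def
  proof
    fix c assume "c \<in> cells lam"
    then have "op_hook c \<le> Max (op_hook ` cells lam)" using fin by (intro Max_ge) auto
    then show "op_hook c + M \<le> card (cells lam)" using sum card by simp
  qed
  \<comment> \<open>Both sides are rescaled by $(M+1)\binom{n+1}{M+1} = (n+1)\binom{n}{M}$.\<close>
  have "Suc M * (Suc n choose Suc M) \<le> Suc M * (Suc n * num_ext (cells lam))"
    using num_ext_lower_bound[OF yd ne excess] card by (intro mult_le_mono2) simp
  then have "Suc n * (n choose M) \<le> Suc n * (Suc M * num_ext (cells lam))"
    using Suc_times_binomial_eq[of n M] by (simp only: mult.commute mult.left_commute)
  then have "n choose M \<le> Suc M * num_ext (cells lam)" by (simp only: Suc_mult_le_cancel1)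
  also have "\<dots> \<le> Suc M * num_SYT lam" by (intro mult_le_mono2 num_ext_le_num_SYT)
  finally have "real (n choose M) \<le> real (Suc M * num_SYT lam)" by (simp only: of_nat_le_iff)
  then have "1 / (real M + 1) * real (n choose M) \<le> real (num_SYT lam)"
    by (simp add: field_simps)
  then show ?thesis using prod_op_hook_le[OF yd excess] card by simp
qed

end
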